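(* Let the data be as in the context. Then the set of feasible initial conditions $$\mathcal{X}^s_N=\{x\in\mathbb{R}^{n_x}:\ \text{there exists }(\mathbf{M},\mathbf{v},\mathbf{Z},\boldsymbol\epsilon)\text{ feasible for }\mathbb{P}^s_N(x)\}$$ of the program $\mathbb{P}^s_N(x)$ equals all of $\mathbb{R}^{n_x}$.
   Context: Notation: $\|y\|_A^2:=y^\top Ay$; $\otimes$ is the Kronecker product; $\mathbb{R}_+$ is the set of nonnegative reals; $\mathbb{S}^n_{++}$ is the set of symmetric positive definite $n\times n$ matrices. System: $x^+=Ax+Bu+Gw$ with $x\in\mathbb{R}^{n_x}$, $u\in\mathbb{R}^{n_u}$, $w\in\mathbb{R}^{n_w}$; $A$ is Schur stable (all eigenvalues strictly inside the unit circle); states are observed exactly; the disturbances are i.i.d., zero mean, with covariance $\Sigma_w\in\mathbb{S}^{n_w}_{++}$, known density $p_w$ and possibly unbounded support $\Delta_w$. Input constraint set $\mathbb{U}=\{u\in\mathbb{R}^{n_u}:H_uu\le k_u\}$, $H_u\in\mathbb{R}^{s\times n_u}$, compact with the origin in its interior. State constraint set $\{x:H_xx\le k_x\}$, $H_x\in\mathbb{R}^{r\times n_x}$, to be satisfied with probability at least $1-\beta$, $\beta\in[0,1)$. Stacked notation over a horizon $N\in\mathbb{N}$: $\mathbf{w}=[w_0^\top,\dots,w_{N-1}^\top]^\top$ with i.i.d. $w_i$ of density $p_w$, $\Sigma_{\mathbf{w}}=I_N\otimes\Sigma_w$; $\mathbf{A}=[I,A^\top,\dots,(A^N)^\top]^\top$;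 $\mathbf{D}\in\mathbb{R}^{n_x(N+1)\times n_xN}$ has, for $p\in\{0,\dots,N\}$, $q\in\{0,\dots,N-1\}$, $(p,q)$ block $A^{p-1-q}$ if $q\le p-1$ and $0$ otherwise; $\mathbf{B}=\mathbf{D}(I_N\otimes B)$; $\mathbf{G}=I_N\otimes G$; $\mathbf{H}_u=I_N\otimes H_u$, $\mathbf{k}_u=[k_u^\top,\dots,k_u^\top]^\top$; $\mathbf{H}_x^{[i]}=e_{i+1}^\top\otimes H_x$ with $e_{i+1}$ the $(i+1)$th standard basis vector of $\mathbb{R}^{N+1}$, and $\mathbf{H}^{[i]}_{x,j}$ its $j$th row. Saturation: $\boldsymbol\varphi(\mathbf{G}\mathbf{w})$ applies scalar (measurable) functions $\varphi_i^l:\mathbb{R}\to\mathbb{R}$, uniformly bounded by $\varphi_{\max}$, componentwise to the entries of $Gw_i$, and $\mathbf{E}[\boldsymbol\varphi(\mathbf{G}\mathbf{w})]=0$. $\mathcal{W}=\{\omega\in\mathbb{R}^{n_xN}:\mathbf{H}_w\omega\le\mathbf{k}_w\}$, $\mathbf{H}_w\in\mathbb{R}^{a\times n_xN}$, is a polytope containing $\boldsymbol\varphi(\mathbf{G}\mathbf{w})$ for all $\mathbf{w}\in\Delta_w^N$. Constraints of $\mathbb{P}^s_N(x)$, for fixed $\delta_j\in\mathbb{R}_+$, $\alpha_j\in[0,1)$ ($j=1,\dots,r$) with $\sum_j\alpha_j=\beta$, in the variables $\mathbf{M}\in\mathbb{R}^{n_uN\times n_xN}$, $\mathbf{v}\in\mathbb{R}^{n_uN}$,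 $\mathbf{Z}\in\mathbb{R}^{a\times sN}$, $\boldsymbol\epsilon=(\epsilon^m_{i,j},\epsilon^v_{i,j})\in\mathbb{R}^{2rN}$ (feasibility does not involve the objective): $\mathbf{M}$ is strictly block lower triangular (in its $N\times N$ array of $n_u\times n_x$ blocks); $\mathbf{H}_u\mathbf{v}+\mathbf{Z}^\top\mathbf{k}_w\le\mathbf{k}_u$; $\mathbf{Z}^\top\mathbf{H}_w=\mathbf{H}_u\mathbf{M}$; $\mathbf{Z}\ge0$ element-wise; and for all $i\in\{1,\dots,N\}$, $j\in\{1,\dots,r\}$: $\mathbf{H}^{[i]}_{x,j}\mathbf{A}x+\mathbf{H}^{[i]}_{x,j}\mathbf{B}\mathbf{v}\le k_{x,j}-\delta_j+\epsilon^m_{i,j}$; $\|\mathbf{y}_{i,j}\|^2_{\Omega_1}+\mathbf{q}_{i,j}^\top\mathbf{y}_{i,j}+c_{i,j}\le\epsilon^v_{i,j}$ with $\mathbf{y}_{i,j}^\top=\mathbf{H}^{[i]}_{x,j}\mathbf{B}\mathbf{M}$; $\epsilon^m_{i,j}\ge0$; $\epsilon^v_{i,j}\ge0$. Here $\Omega_1=\mathbf{E}[\boldsymbol\varphi(\mathbf{G}\mathbf{w})\boldsymbol\varphi(\mathbf{G}\mathbf{w})^\top]$, $\Omega_2=\mathbf{E}[\boldsymbol\varphi(\mathbf{G}\mathbf{w})\mathbf{w}^\top]$, $\mathbf{q}_{i,j}^\top=2\mathbf{H}^{[i]}_{x,j}\mathbf{D}\mathbf{G}\Omega_2^\top$, $c_{i,j}=\mathbf{H}^{[i]}_{x,j}\mathbf{D}\mathbf{G}\Sigma_{\mathbf{w}}\mathbf{G}^\top\mathbf{D}^\top\mathbf{H}^{[i]\top}_{x,j}-\alpha_j\delta_j^2(1-\alpha_j)^{-1}$.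 *)

theory Defs
  imports
    "HOL-Probability.Probability"
    "Jordan_Normal_Form.Matrix"
    "Jordan_Normal_Form.Char_Poly"
begin

unbundle no vec_syntax and no inner_syntax
hide_const (open)
  Finite_Cartesian_Product.vec Finite_Cartesian_Product.mat Finite_Cartesian_Product.row
  Finite_Cartesian_Product.vec.vec_nth

text \<open>
  Blocks, rows and components are counted from 0. The time index i of the state constraints
  still runs over 1, ..., N, so that block row i of the stacked trajectory is the state at time i.
\<close>

section \<open>Euclidean space of dimension n\<close>

text \<open>
  The type of vectors with explicit dimension carries neither a topology nor a measure. Both are
  taken from the n-fold product of the real line, through the coordinate functions (undefined
  from n on, as the product spaces require).
\<close>

definition coords :: "real vec \<Rightarrow> nat \<Rightarrow> real" where
  "coords y = (\<lambda>k\<in>{..<dim_vec y}. y $ k)"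

definition lborel_n :: "nat \<Rightarrow> (nat \<Rightarrow> real) measure" where
  "lborel_n n = Pi\<^sub>M {..<n} (\<lambda>_. lborel)"

definition compact_vecs :: "nat \<Rightarrow> real vec set \<Rightarrow> bool" where
  "compact_vecs n S \<longleftrightarrow> S \<subseteq> carrier_vec n \<and> compactin (powertop_real {..<n}) (coords ` S)"

definition interior_vecs :: "nat \<Rightarrow> real vec set \<Rightarrow> real vec set" where
  "interior_vecs n S = {y \<in> carrier_vec n. coords y \<in> powertop_real {..<n} interior_of (coords ` S)}"

definition has_density :: "'o measure \<Rightarrow> nat \<Rightarrow> ('o \<Rightarrow> real vec) \<Rightarrow> (real vec \<Rightarrow> real) \<Rightarrow> bool" where
  "has_density P n X p \<longleftrightarrow>
     (\<forall>\<omega>\<in>space P. X \<omega> \<in> carrier_vec n) \<and> (\<forall>y\<in>carrier_vec n. 0 \<le> p y) \<and>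
     distributed P (lborel_n n) (\<lambda>\<omega>. coords (X \<omega>)) (\<lambda>f. ennreal (p (vec n f)))"

text \<open>Topological support of the law with density p.\<close>

definition density_support :: "nat \<Rightarrow> (real vec \<Rightarrow> real) \<Rightarrow> real vec set" where
  "density_support n p =
     {y \<in> carrier_vec n. \<forall>V. openin (powertop_real {..<n}) V \<and> coords y \<in> V \<longrightarrow>
        emeasure (density (lborel_n n) (\<lambda>f. ennreal (p (vec n f)))) V > 0}"

definition mean_vec :: "'o measure \<Rightarrow> nat \<Rightarrow> ('o \<Rightarrow> real vec) \<Rightarrow> real vec" where
  "mean_vec P n X = vec n (\<lambda>k. \<integral>\<omega>. X \<omega> $ k \<partial>P)"

text \<open>The second-moment matrix E[X Y^T].\<close>

definition mean_outer ::
  "'o measure \<Rightarrow> nat \<Rightarrow> nat \<Rightarrow> ('o \<Rightarrow> real vec) \<Rightarrow> ('o \<Rightarrow> real vec) \<Rightarrow> real mat" where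
  "mean_outer P m n X Y = mat m n (\<lambda>(k, l). \<integral>\<omega>. X \<omega> $ k * Y \<omega> $ l \<partial>P)"

definition covariance_mat :: "'o measure \<Rightarrow> nat \<Rightarrow> ('o \<Rightarrow> real vec) \<Rightarrow> real mat" where
  "covariance_mat P n X =
     mean_outer P n n (\<lambda>\<omega>. X \<omega> - mean_vec P n X) (\<lambda>\<omega>. X \<omega> - mean_vec P n X)"

section \<open>Matrices\<close>

definition sym_pos_def :: "nat \<Rightarrow> real mat \<Rightarrow> bool" where
  "sym_pos_def n S \<longleftrightarrow> S \<in> carrier_mat n n \<and> transpose_mat S = S \<and>
     (\<forall>y\<in>carrier_vec n. y \<noteq> 0\<^sub>v n \<longrightarrow> y \<bullet> (S *\<^sub>v y) > 0)"

definition schur_stable :: "real mat \<Rightarrow> bool" where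
  "schur_stable A \<longleftrightarrow> (\<forall>z. eigenvalue (map_mat complex_of_real A) z \<longrightarrow> cmod z < 1)"

definition kron :: "real mat \<Rightarrow> real mat \<Rightarrow> real mat" (infixl "\<otimes>\<^sub>K" 72) where
  "X \<otimes>\<^sub>K Y = mat (dim_row X * dim_row Y) (dim_col X * dim_col Y)
     (\<lambda>(k, l). X $$ (k div dim_row Y, l div dim_col Y) * Y $$ (k mod dim_row Y, l mod dim_col Y))"

definition stack_vec :: "nat \<Rightarrow> nat \<Rightarrow> (nat \<Rightarrow> real vec) \<Rightarrow> real vec" where
  "stack_vec N n f = vec (N * n) (\<lambda>k. f (k div n) $ (k mod n))"

definition weighted_norm_sq :: "real mat \<Rightarrow> real vec \<Rightarrow> real" where
  "weighted_norm_sq S y = y \<bullet> (S *\<^sub>v y)"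

definition polyhedron_vecs :: "real mat \<Rightarrow> real vec \<Rightarrow> real vec set" where
  "polyhedron_vecs H k = {y \<in> carrier_vec (dim_col H). H *\<^sub>v y \<le> k}"

definition bounded_vecs :: "real vec set \<Rightarrow> bool" where
  "bounded_vecs S \<longleftrightarrow> (\<exists>C. \<forall>y\<in>S. \<forall>k<dim_vec y. \<bar>y $ k\<bar> \<le> C)"

section \<open>Stacked dynamics over the horizon\<close>

definition stacked_A :: "nat \<Rightarrow> real mat \<Rightarrow> real mat" where
  "stacked_A N A = (let n = dim_row A in
     mat ((N + 1) * n) n (\<lambda>(k, l). (A ^\<^sub>m (k div n)) $$ (k mod n, l)))"

definition stacked_D :: "nat \<Rightarrow> real mat \<Rightarrow> real mat" where
  "stacked_D N A = (let n = dim_row A in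
     mat ((N + 1) * n) (N * n) (\<lambda>(k, l).
       let p = k div n; q = l div n in
       if q < p then (A ^\<^sub>m (p - 1 - q)) $$ (k mod n, l mod n) else 0))"

definition stacked_B :: "nat \<Rightarrow> real mat \<Rightarrow> real mat \<Rightarrow> real mat" where
  "stacked_B N A B = stacked_D N A * (1\<^sub>m N \<otimes>\<^sub>K B)"

definition state_selector :: "nat \<Rightarrow> real mat \<Rightarrow> nat \<Rightarrow> real mat" where
  "state_selector N H\<^sub>x i = mat_of_row (unit_vec (N + 1) i) \<otimes>\<^sub>K H\<^sub>x"

definition saturate :: "nat \<Rightarrow> nat \<Rightarrow> (nat \<Rightarrow> nat \<Rightarrow> real \<Rightarrow> real) \<Rightarrow> real vec \<Rightarrow> real vec" where
  "saturate N n \<phi> y = vec (N * n) (\<lambda>k. \<phi> (k div n) (k mod n) (y $ k))"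

definition sat_dist ::
  "nat \<Rightarrow> real mat \<Rightarrow> (nat \<Rightarrow> nat \<Rightarrow> real \<Rightarrow> real) \<Rightarrow> (nat \<Rightarrow> real vec) \<Rightarrow> real vec" where
  "sat_dist N G \<phi> w =
     saturate N (dim_row G) \<phi> ((1\<^sub>m N \<otimes>\<^sub>K G) *\<^sub>v stack_vec N (dim_col G) w)"

definition Omega1 ::
  "'o measure \<Rightarrow> nat \<Rightarrow> real mat \<Rightarrow> (nat \<Rightarrow> nat \<Rightarrow> real \<Rightarrow> real) \<Rightarrow> (nat \<Rightarrow> 'o \<Rightarrow> real vec) \<Rightarrow> real mat"
  where
  "Omega1 P N G \<phi> w = mean_outer P (N * dim_row G) (N * dim_row G)
     (\<lambda>\<omega>. sat_dist N G \<phi> (\<lambda>i. w i \<omega>)) (\<lambda>\<omega>. sat_dist N G \<phi> (\<lambda>i. w i \<omega>))"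

definition Omega2 ::
  "'o measure \<Rightarrow> nat \<Rightarrow> real mat \<Rightarrow> (nat \<Rightarrow> nat \<Rightarrow> real \<Rightarrow> real) \<Rightarrow> (nat \<Rightarrow> 'o \<Rightarrow> real vec) \<Rightarrow> real mat"
  where
  "Omega2 P N G \<phi> w = mean_outer P (N * dim_row G) (N * dim_col G)
     (\<lambda>\<omega>. sat_dist N G \<phi> (\<lambda>i. w i \<omega>)) (\<lambda>\<omega>. stack_vec N (dim_col G) (\<lambda>i. w i \<omega>))"

section \<open>The program\<close>

definition strictly_block_lower_triangular :: "nat \<Rightarrow> nat \<Rightarrow> real mat \<Rightarrow> bool" where
  "strictly_block_lower_triangular m n M \<longleftrightarrow>
     (\<forall>k<dim_row M. \<forall>l<dim_col M. k div m \<le> l div n \<longrightarrow> M $$ (k, l) = 0)"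

text \<open>
  \<open>E1\<close> and \<open>E2\<close> are the moment matrices; \<open>\<epsilon>\<^sub>m i j\<close> and \<open>\<epsilon>\<^sub>v i j\<close> are the slack variables, of which
  only the entries with \<open>1 \<le> i \<le> N\<close> and \<open>j < r\<close> matter.
\<close>

definition smpc_feasible ::
  "nat \<Rightarrow> real mat \<Rightarrow> real mat \<Rightarrow> real mat \<Rightarrow> real mat \<Rightarrow> real vec \<Rightarrow> real mat \<Rightarrow> real vec \<Rightarrow>
   real mat \<Rightarrow> real vec \<Rightarrow> real mat \<Rightarrow> real mat \<Rightarrow> real mat \<Rightarrow> (nat \<Rightarrow> real) \<Rightarrow> (nat \<Rightarrow> real) \<Rightarrow> real vec \<Rightarrow>
   real mat \<Rightarrow> real vec \<Rightarrow> real mat \<Rightarrow> (nat \<Rightarrow> nat \<Rightarrow> real) \<Rightarrow> (nat \<Rightarrow> nat \<Rightarrow> real) \<Rightarrow> bool" where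
  "smpc_feasible N A B G H\<^sub>u k\<^sub>u H\<^sub>x k\<^sub>x H\<^sub>w k\<^sub>w S\<^sub>w E1 E2 \<delta> \<alpha> x M v Z \<epsilon>\<^sub>m \<epsilon>\<^sub>v \<longleftrightarrow>
    (let nx = dim_row A; nu = dim_col B; s = dim_row H\<^sub>u; r = dim_row H\<^sub>x; a = dim_row H\<^sub>w;
         AA = stacked_A N A; BB = stacked_B N A B; DD = stacked_D N A; GG = 1\<^sub>m N \<otimes>\<^sub>K G;
         HU = 1\<^sub>m N \<otimes>\<^sub>K H\<^sub>u; kU = stack_vec N s (\<lambda>_. k\<^sub>u); S = 1\<^sub>m N \<otimes>\<^sub>K S\<^sub>w
     in
      M \<in> carrier_mat (N * nu) (N * nx) \<and> v \<in> carrier_vec (N * nu) \<and> Z \<in> carrier_mat a (N * s) \<and>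
      strictly_block_lower_triangular nu nx M \<and>
      HU *\<^sub>v v + transpose_mat Z *\<^sub>v k\<^sub>w \<le> kU \<and>
      transpose_mat Z * H\<^sub>w = HU * M \<and>
      0\<^sub>m a (N * s) \<le> Z \<and>
      (\<forall>i\<in>{1..N}. \<forall>j<r.
        let Hi = state_selector N H\<^sub>x i;
            y = row (Hi * BB * M) j;
            q = 2 \<cdot>\<^sub>v row (Hi * DD * GG * transpose_mat E2) j;
            c = (Hi * DD * GG * S * transpose_mat GG * transpose_mat DD * transpose_mat Hi) $$ (j, j)
              - \<alpha> j * (\<delta> j)\<^sup>2 / (1 - \<alpha> j)
        in
          row (Hi * AA) j \<bullet> x + row (Hi * BB) j \<bullet> v \<le> k\<^sub>x $ j - \<delta> j + \<epsilon>\<^sub>m i j \<and>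
          weighted_norm_sq E1 y + q \<bullet> y + c \<le> \<epsilon>\<^sub>v i j \<and>
          0 \<le> \<epsilon>\<^sub>m i j \<and> 0 \<le> \<epsilon>\<^sub>v i j))"

end

theory Submission
  imports Defs
begin

text \<open>
  The two slack families soften every state constraint, so \<open>\<epsilon>\<^sub>m i j\<close> and \<open>\<epsilon>\<^sub>v i j\<close> absorb whatever
  value the state constraints take, and only the input constraints can obstruct feasibility. These
  do not involve \<open>x\<close>. They are met by the policy that applies no input at all, that is \<open>M = 0\<close>,
  \<open>v = 0\<close> with the dual certificate \<open>Z = 0\<close>: what remains is \<open>0 \<le> k\<^sub>u\<close>, which says that the origin
  is an admissible input (\<open>nonneg_of_zero_interior\<close>).
\<close>

lemma inj_on_coords: "inj_on coords (carrier_vec n)"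
proof (rule inj_onI)
  fix y z :: "real vec"
  assume yz: "y \<in> carrier_vec n" "z \<in> carrier_vec n" and eq: "coords y = coords z"
  show "y = z"
  proof (rule eq_vecI)
    fix k assume "k < dim_vec z"
    then show "y $ k = z $ k"
      using yz fun_cong[OF eq, of k] by (simp add: coords_def)
  qed (use yz in auto)
qed

text \<open>
  The interior is taken among coordinate functions; injectivity of \<open>coords\<close> carries membership in
  the image back to the vectors.
\<close>

lemma interior_vecs_subset:
  assumes "S \<subseteq> carrier_vec n"
  shows "interior_vecs n S \<subseteq> S"
proof
  fix y assume "y \<in> interior_vecs n S"
  then have y: "y \<in> carrier_vec n" and "coords y \<in> coords ` S"
    using interior_of_subset by (fastforce simp: interior_vecs_def)+
  then show "y \<in> S"
    using inj_on_image_mem_iff[OF inj_on_coords y assms] by blast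
qed

lemma nonneg_of_zero_interior:
  assumes "H \<in> carrier_mat s n" "0\<^sub>v n \<in> interior_vecs n (polyhedron_vecs H k)"
  shows "0\<^sub>v s \<le> k"
proof -
  have "polyhedron_vecs H k \<subseteq> carrier_vec n"
    using assms(1) by (auto simp: polyhedron_vecs_def)
  then have "0\<^sub>v n \<in> polyhedron_vecs H k"
    using interior_vecs_subset assms(2) by blast
  moreover have "H *\<^sub>v 0\<^sub>v n = 0\<^sub>v s"
    using assms(1) by auto
  ultimately show ?thesis
    by (simp add: polyhedron_vecs_def)
qed

lemma kron_carrier_mat [intro]:
  "X \<in> carrier_mat m n \<Longrightarrow> Y \<in> carrier_mat p q \<Longrightarrow> X \<otimes>\<^sub>K Y \<in> carrier_mat (m * p) (n * q)"
  by (auto simp: kron_def)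

lemma stack_vec_nonneg:
  assumes "0\<^sub>v n \<le> k"
  shows "0\<^sub>v (N * n) \<le> stack_vec N n (\<lambda>_. k)"
proof -
  have "0 \<le> k $ (l mod n)" if "l < N * n" for l
  proof -
    have "l mod n < n"
      using that by (cases "n = 0") auto
    then show ?thesis
      using assms by (auto simp: less_eq_vec_def)
  qed
  then show ?thesis
    by (auto simp: less_eq_vec_def stack_vec_def)
qed

text \<open>
  Slack \<open>\<epsilon>\<^sub>m i j\<close> is chosen as the positive part of the amount by which the mean constraint is
  exceeded, and \<open>\<epsilon>\<^sub>v i j\<close> as the positive part of the left side of the variance constraint.
\<close>

lemma smpc_feasible_zero_policy:
  assumes "A \<in> carrier_mat nx nx" "B \<in> carrier_mat nx nu"
    and "H\<^sub>u \<in> carrier_mat s nu" "0\<^sub>v s \<le> k\<^sub>u"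
    and "H\<^sub>w \<in> carrier_mat a (N * nx)" "k\<^sub>w \<in> carrier_vec a"
  shows "\<exists>\<epsilon>\<^sub>m \<epsilon>\<^sub>v. smpc_feasible N A B G H\<^sub>u k\<^sub>u H\<^sub>x k\<^sub>x H\<^sub>w k\<^sub>w S\<^sub>w E1 E2 \<delta> \<alpha> x
           (0\<^sub>m (N * nu) (N * nx)) (0\<^sub>v (N * nu)) (0\<^sub>m a (N * s)) \<epsilon>\<^sub>m \<epsilon>\<^sub>v"
proof -
  have slack: "\<exists>\<epsilon>\<^sub>m \<epsilon>\<^sub>v. \<forall>i\<in>{1..N}. \<forall>j<dim_row H\<^sub>x.
      f i j \<le> k\<^sub>x $ j - \<delta> j + \<epsilon>\<^sub>m i j \<and> g i j \<le> \<epsilon>\<^sub>v i j \<and> 0 \<le> \<epsilon>\<^sub>m i j \<and> 0 \<le> \<epsilon>\<^sub>v i j"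
    for f g :: "nat \<Rightarrow> nat \<Rightarrow> real"
    by (intro exI[of _ "\<lambda>i j. max 0 (f i j - (k\<^sub>x $ j - \<delta> j))"] exI[of _ "\<lambda>i j. max 0 (g i j)"])
       auto
  have HU: "1\<^sub>m N \<otimes>\<^sub>K H\<^sub>u \<in> carrier_mat (N * s) (N * nu)"
    using assms(3) by auto
  have dims: "dim_row A = nx" "dim_col B = nu" "dim_row H\<^sub>u = s" "dim_row H\<^sub>w = a"
    using assms by auto
  have input: "(1\<^sub>m N \<otimes>\<^sub>K H\<^sub>u) *\<^sub>v 0\<^sub>v (N * nu) + transpose_mat (0\<^sub>m a (N * s)) *\<^sub>v k\<^sub>w
      \<le> stack_vec N s (\<lambda>_. k\<^sub>u)"
  proof -
    have "(1\<^sub>m N \<otimes>\<^sub>K H\<^sub>u) *\<^sub>v 0\<^sub>v (N * nu) = 0\<^sub>v (N * s)"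
      using HU by auto
    moreover have "transpose_mat (0\<^sub>m a (N * s)) *\<^sub>v k\<^sub>w = 0\<^sub>v (N * s)"
      using assms(6) by auto
    ultimately show ?thesis
      using stack_vec_nonneg[OF assms(4), of N] by simp
  qed
  have dual: "transpose_mat (0\<^sub>m a (N * s)) * H\<^sub>w = (1\<^sub>m N \<otimes>\<^sub>K H\<^sub>u) * 0\<^sub>m (N * nu) (N * nx)"
    using HU assms(5) by simp
  have causal: "strictly_block_lower_triangular nu nx (0\<^sub>m (N * nu) (N * nx))"
    by (simp add: strictly_block_lower_triangular_def)
  show ?thesis
    unfolding smpc_feasible_def Let_def dims ex_simps
    by (intro conjI input dual causal slack) auto
qed

theorem mainTheorem3:
  fixes N nx nu nw s r a :: nat
    and A B G H\<^sub>u H\<^sub>x H\<^sub>w S\<^sub>w :: "real mat"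
    and k\<^sub>u k\<^sub>x k\<^sub>w :: "real vec"
    and P :: "'o measure"
    and w :: "nat \<Rightarrow> 'o \<Rightarrow> real vec"
    and p\<^sub>w :: "real vec \<Rightarrow> real"
    and \<phi> :: "nat \<Rightarrow> nat \<Rightarrow> real \<Rightarrow> real"
    and \<phi>max \<beta> :: real
    and \<delta> \<alpha> :: "nat \<Rightarrow> real"
  assumes "A \<in> carrier_mat nx nx" and "B \<in> carrier_mat nx nu" and "G \<in> carrier_mat nx nw"
    and "schur_stable A"
    and "H\<^sub>u \<in> carrier_mat s nu" and "k\<^sub>u \<in> carrier_vec s"
    and "compact_vecs nu (polyhedron_vecs H\<^sub>u k\<^sub>u)"
    and "0\<^sub>v nu \<in> interior_vecs nu (polyhedron_vecs H\<^sub>u k\<^sub>u)"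
    and "H\<^sub>x \<in> carrier_mat r nx" and "k\<^sub>x \<in> carrier_vec r"
    and "0 \<le> \<beta>" and "\<beta> < 1"
    and "sym_pos_def nw S\<^sub>w"
    and "prob_space P"
    and "\<forall>i<N. has_density P nw (w i) p\<^sub>w"
    and "prob_space.indep_vars P (\<lambda>_. lborel_n nw) (\<lambda>i \<omega>. coords (w i \<omega>)) {..<N}"
    and "\<forall>i<N. \<forall>l<nw. integrable P (\<lambda>\<omega>. (w i \<omega> $ l)\<^sup>2)"
    and "\<forall>i<N. mean_vec P nw (w i) = 0\<^sub>v nw"
    and "\<forall>i<N. covariance_mat P nw (w i) = S\<^sub>w"
    and "\<forall>i<N. \<forall>l<nx. \<phi> i l \<in> borel_measurable borel"
    and "\<forall>i<N. \<forall>l<nx. \<forall>t. \<bar>\<phi> i l t\<bar> \<le> \<phi>max"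
    and "mean_vec P (N * nx) (\<lambda>\<omega>. sat_dist N G \<phi> (\<lambda>i. w i \<omega>)) = 0\<^sub>v (N * nx)"
    and "H\<^sub>w \<in> carrier_mat a (N * nx)" and "k\<^sub>w \<in> carrier_vec a"
    and "bounded_vecs (polyhedron_vecs H\<^sub>w k\<^sub>w)"
    and "\<forall>d. (\<forall>i<N. d i \<in> density_support nw p\<^sub>w) \<longrightarrow> sat_dist N G \<phi> d \<in> polyhedron_vecs H\<^sub>w k\<^sub>w"
    and "\<forall>j<r. 0 \<le> \<delta> j" and "\<forall>j<r. 0 \<le> \<alpha> j \<and> \<alpha> j < 1"
    and "(\<Sum>j<r. \<alpha> j) = \<beta>"
  shows "{x \<in> carrier_vec nx. \<exists>M v Z \<epsilon>\<^sub>m \<epsilon>\<^sub>v.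
            smpc_feasible N A B G H\<^sub>u k\<^sub>u H\<^sub>x k\<^sub>x H\<^sub>w k\<^sub>w S\<^sub>w
              (Omega1 P N G \<phi> w) (Omega2 P N G \<phi> w) \<delta> \<alpha> x M v Z \<epsilon>\<^sub>m \<epsilon>\<^sub>v}
         = carrier_vec nx"
proof -
  have "0\<^sub>v s \<le> k\<^sub>u"
    using nonneg_of_zero_interior assms(5,8) by blast
  then show ?thesis
    using smpc_feasible_zero_policy[OF assms(1,2,5) _ assms(23,24)] by blast
qed

end
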